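(* For a topoframe $L_\tau=(L,\tau)$, the following statements are equivalent. (1) $L_\tau$ is a $P$-topoframe. (2) $\mathcal{R}L_\tau$ is a regular ring.
   Context: A frame is a complete lattice $L$ (top $\top$, bottom $\bot$) with $a\wedge\bigvee S=\bigvee\{a\wedge s: s\in S\}$ for all $a\in L$, $S\subseteq L$. A frame homomorphism preserves finite meets (including $\top$) and arbitrary joins (including $\bot$). A topoframe $L_\tau$ is a pair $(L,\tau)$ where $L$ is a frame and $\tau$ is a subframe of $L$ all of whose elements are complemented in $L$. A real-continuous function on $L_\tau$ is a frame homomorphism $f:\mathcal{P}(\mathbb{R})\to L$ (where $\mathcal P(\mathbb R)$ is the power set of $\mathbb R$) such that $f(\{x\in\mathbb R: p<x<q\})\in\tau$ for all $p,q\in\mathbb{Q}$. $\mathcal{R}L_\tau$ is the set of all these; it is a commutative (reduced) ring with identity under $(f\diamond g)(X)=\bigvee\{f(Y)\wedge g(Z): Y\diamond Z\subseteq X\}$ for $\diamond\in\{+,\cdot\}$, where $Y\diamond Z=\{y\diamond z: y\in Y, z\in Z\}$, with $(-f)(X)=f(-X)$, and with the constants $\mathbf{r}$ ($r\in\mathbb R$) given by $\mathbf r(X)=\top$ if $r\in X$ and $\bot$ otherwise; $\mathbf 0$ and $\mathbf 1$ are the zero and identity. For $f\in\mathcal{R}L_\tau$, $z(f)=f(\{0\})$. $L_\tau$ is a $P$-topoframe if $z(f)\in\tau$ for all $f\in\mathcal{R}L_\tau$. A commutative ring $A$ is regular (in the sense of von Neumann) if for every $x\in A$ there is $y\in A$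 with $x=x^2y$. *)

theory Defs
  imports Complex_Main "HOL-Algebra.Ring"
begin

hide_const (open) Order.top

class frame = complete_lattice +
  assumes inf_Sup_distrib: "inf a (Sup S) = (SUP s\<in>S. inf a s)"

instance set :: (type) frame
  by standard auto

definition frame_hom :: "('a::frame \<Rightarrow> 'b::frame) \<Rightarrow> bool" where
  "frame_hom f \<longleftrightarrow>
     f top = top \<and>
     (\<forall>a b. f (inf a b) = inf (f a) (f b)) \<and>
     (\<forall>S. f (Sup S) = Sup (f ` S))"

(* Taking S = {} in the last clause gives bot \<in> T. *)
definition subframe :: "'a::frame set \<Rightarrow> bool" where
  "subframe T \<longleftrightarrow>
     top \<in> T \<and>
     (\<forall>a\<in>T. \<forall>b\<in>T. inf a b \<in> T) \<and>
     (\<forall>S\<subseteq>T. Sup S \<in> T)"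

definition complemented :: "'a::frame \<Rightarrow> bool" where
  "complemented a \<longleftrightarrow> (\<exists>b. inf a b = bot \<and> sup a b = top)"

(* The frame L is the whole type 'a. Complements are taken in L and need not lie in \<tau>. *)
definition topoframe :: "'a::frame set \<Rightarrow> bool" where
  "topoframe \<tau> \<longleftrightarrow> subframe \<tau> \<and> (\<forall>a\<in>\<tau>. complemented a)"

definition real_continuous :: "'a::frame set \<Rightarrow> (real set \<Rightarrow> 'a) \<Rightarrow> bool" where
  "real_continuous \<tau> f \<longleftrightarrow>
     frame_hom f \<and> (\<forall>p q :: rat. f {x. of_rat p < x \<and> x < of_rat q} \<in> \<tau>)"

definition rc_op ::
  "(real \<Rightarrow> real \<Rightarrow> real) \<Rightarrow> (real set \<Rightarrow> 'a::frame) \<Rightarrow> (real set \<Rightarrow> 'a) \<Rightarrow> real set \<Rightarrow> 'a" where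
  "rc_op d f g X = Sup {inf (f Y) (g Z) | Y Z. {d y z | y z. y \<in> Y \<and> z \<in> Z} \<subseteq> X}"

definition rc_const :: "real \<Rightarrow> real set \<Rightarrow> 'a::frame" where
  "rc_const r X = (if r \<in> X then top else bot)"

definition RL :: "'a::frame set \<Rightarrow> (real set \<Rightarrow> 'a) ring" where
  "RL \<tau> = \<lparr>carrier = {f. real_continuous \<tau> f},
           mult = rc_op (*),
           one = rc_const 1,
           zero = rc_const 0,
           add = rc_op (+)\<rparr>"

definition zero_element :: "(real set \<Rightarrow> 'a::frame) \<Rightarrow> 'a" where
  "zero_element f = f {0}"

definition P_topoframe :: "'a::frame set \<Rightarrow> bool" where
  "P_topoframe \<tau> \<longleftrightarrow>
     topoframe \<tau> \<and> (\<forall>f\<in>carrier (RL \<tau>). zero_element f \<in> \<tau>)"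

locale von_neumann_regular_ring = cring R for R (structure) +
  assumes regular: "x \<in> carrier R \<Longrightarrow> \<exists>y\<in>carrier R. x = x [^] (2::nat) \<otimes> y"

end

theory Submission
  imports Defs
begin

text \<open>
  A frame homomorphism \<open>f\<close> from a power set into \<open>L\<close> is the same thing as a partition of \<open>top\<close>
  into the pieces \<open>f {x}\<close>, and \<open>a \<le> f {x}\<close> says that \<open>f\<close> has the constant value \<open>x\<close> on the part
  \<open>a\<close> of \<open>L\<close>.  Finitely many homomorphisms have a common refining partition, on each piece of
  which all of them are constant, and an operation \<open>rc_op d\<close> acts on these constants as \<open>d\<close> does
  (\<open>rc_op_value\<close>).  So two homomorphisms built from others by such operations agree as soon as
  the corresponding real numbers do (\<open>frame_hom_eqI3\<close>), and every commutative ring law of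
  \<open>RL \<tau>\<close> is inherited from the reals.  The refining partition also gives closure under the
  operations: \<open>rc_op d f g\<close> is the pairing of \<open>f\<close> and \<open>g\<close>, a homomorphism on sets of points of the
  plane, evaluated at preimages under \<open>d\<close>; when \<open>d\<close> is continuous, the preimage of an open set is
  a union of open rectangles \<open>U \<times> V\<close>, each of which contributes \<open>inf (f U) (g V) \<in> \<tau>\<close>.

  For regularity, the natural quasi-inverse of \<open>f\<close> inverts each nonzero value and keeps the
  value \<open>0\<close>.  Inversion is continuous away from \<open>0\<close>, so the only obstruction to continuity of this
  quasi-inverse is the piece \<open>f {0}\<close>, and that piece is in \<open>\<tau>\<close> for a \<open>P\<close>-topoframe
  (\<open>real_continuous_quasi_inverse\<close>).  Conversely, if \<open>f = f\<^sup>2 g\<close> then on each nonzero piece the values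
  satisfy \<open>y = y\<^sup>2 z\<close>, so \<open>y z\<close> is \<open>0\<close> where \<open>f\<close> vanishes and \<open>1\<close> elsewhere.
  The zero element of \<open>f\<close> is therefore the value of \<open>f g\<close> on the interval \<open>(-1, 1)\<close>, hence lies in
  \<open>\<tau>\<close> (\<open>zero_element_of_regular\<close>).
\<close>

section \<open>Frame homomorphisms on power sets as partitions\<close>

lemma frame_SUP_inf:
  fixes c :: "'i \<Rightarrow> 'a::frame"
  shows "inf (SUP i\<in>I. c i) (SUP j\<in>J. e j) = (SUP i\<in>I. SUP j\<in>J. inf (c i) (e j))"
proof -
  have "inf (SUP i\<in>I. c i) (SUP j\<in>J. e j) = (SUP i\<in>I. inf (SUP j\<in>J. e j) (c i))"
    by (subst inf.commute) (simp add: inf_Sup_distrib image_image)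
  also have "\<dots> = (SUP i\<in>I. SUP j\<in>J. inf (c i) (e j))"
    by (subst inf.commute) (simp add: inf_Sup_distrib image_image)
  finally show ?thesis .
qed

lemma frame_hom_inf: "frame_hom f \<Longrightarrow> f (inf a b) = inf (f a) (f b)"
  and frame_hom_top: "frame_hom f \<Longrightarrow> f top = top"
  and frame_hom_Sup: "frame_hom f \<Longrightarrow> f (Sup S) = Sup (f ` S)"
  by (auto simp: frame_hom_def)

lemma frame_hom_empty: "frame_hom f \<Longrightarrow> f {} = bot"
  using frame_hom_Sup[of f "{}"] by simp

lemma frame_hom_mono: "frame_hom f \<Longrightarrow> a \<le> b \<Longrightarrow> f a \<le> f b"
  by (metis frame_hom_inf inf.absorb_iff1)

lemma frame_hom_eq_SUP_singletons:
  assumes "frame_hom f"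
  shows "f X = (SUP x\<in>X. f {x})"
  using frame_hom_Sup[OF assms, of "(\<lambda>x. {x}) ` X"] by (simp add: image_image)

lemma frame_hom_disjoint_values:
  assumes "frame_hom f" "x \<noteq> y"
  shows "inf (f {x}) (f {y}) = bot"
proof -
  have "inf (f {x}) (f {y}) = f ({x} \<inter> {y})"
    using frame_hom_inf[OF assms(1), of "{x}" "{y}"] by simp
  also have "{x} \<inter> {y} = {}" using assms by auto
  finally show ?thesis using assms by (simp add: frame_hom_empty)
qed

text \<open>
  Finite meets are preserved because distinct pieces do not overlap: in the double join that
  distributivity produces, only the diagonal terms survive.
\<close>

lemma frame_hom_partition:
  fixes c :: "'i \<Rightarrow> 'a::frame"
  assumes cover: "(SUP i. c i) = top"
    and disjoint: "\<And>i j. i \<noteq> j \<Longrightarrow> inf (c i) (c j) = bot"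
  shows "frame_hom (\<lambda>X. SUP i\<in>X. c i)"
  unfolding frame_hom_def
proof (intro conjI allI)
  show "(SUP i\<in>top. c i) = top" using cover by simp
next
  fix A B :: "'i set"
  show "(SUP i\<in>inf A B. c i) = inf (SUP i\<in>A. c i) (SUP i\<in>B. c i)"
  proof (rule antisym)
    show "(SUP i\<in>inf A B. c i) \<le> inf (SUP i\<in>A. c i) (SUP i\<in>B. c i)"
      by (auto intro!: SUP_least SUP_upper)
    show "inf (SUP i\<in>A. c i) (SUP i\<in>B. c i) \<le> (SUP i\<in>inf A B. c i)"
      unfolding frame_SUP_inf
    proof (intro SUP_least)
      fix i j assume "i \<in> A" "j \<in> B"
      then show "inf (c i) (c j) \<le> (SUP i\<in>inf A B. c i)"
        by (cases "i = j") (auto intro: SUP_upper simp: disjoint)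
    qed
  qed
next
  fix S :: "'i set set"
  show "(SUP i\<in>Sup S. c i) = Sup ((\<lambda>X. SUP i\<in>X. c i) ` S)"
    by (rule SUP_UNION[of c id S, simplified])
qed

lemma frame_hom_vimage:
  assumes "frame_hom f"
  shows "frame_hom (\<lambda>X. f (\<phi> -` X))"
  using assms unfolding frame_hom_def
  by (simp add: image_image vimage_Union)

text \<open>
  The pieces of \<open>h\<close> cover \<open>top\<close>, and on a piece where both homomorphisms have the value \<open>v\<close>
  they both restrict to the whole piece or to nothing, according to whether \<open>v \<in> X\<close>.
\<close>

lemma frame_hom_eqI:
  fixes h :: "'i set \<Rightarrow> 'a::frame" and F G :: "'j set \<Rightarrow> 'a"
  assumes h: "frame_hom h" and F: "frame_hom F" and G: "frame_hom G"
    and common: "\<And>i. \<exists>v. h {i} \<le> F {v} \<and> h {i} \<le> G {v}"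
  shows "F = G"
proof -
  have le: "F X \<le> G X"
    if F: "frame_hom F" and G: "frame_hom G"
      and common: "\<And>i. \<exists>v. h {i} \<le> F {v} \<and> h {i} \<le> G {v}" for F G :: "'j set \<Rightarrow> 'a" and X
  proof -
    have "F X = inf (F X) (SUP i. h {i})"
      using frame_hom_eq_SUP_singletons[OF h, of UNIV] frame_hom_top[OF h] by simp
    also have "\<dots> = (SUP i. inf (F X) (h {i}))"
      by (simp add: inf_Sup_distrib image_image)
    also have "\<dots> \<le> G X"
    proof (rule SUP_least)
      fix i
      obtain v where v: "h {i} \<le> F {v}" "h {i} \<le> G {v}" using common by blast
      show "inf (F X) (h {i}) \<le> G X"
      proof (cases "v \<in> X")
        case True
        then have "G {v} \<le> G X" by (intro frame_hom_mono[OF G]) simp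
        then show ?thesis using v(2) by (meson inf.coboundedI2 order_trans)
      next
        case False
        have "inf (F X) (h {i}) \<le> inf (F X) (F {v})" using v(1) by (rule inf_mono[OF order_refl])
        also have "\<dots> = F (X \<inter> {v})" by (simp add: frame_hom_inf[OF F])
        also have "X \<inter> {v} = {}" using False by auto
        finally show ?thesis by (simp add: frame_hom_empty[OF F] bot_unique)
      qed
    qed
    finally show ?thesis .
  qed
  show ?thesis
    by (rule ext, rule antisym) (use le F G common in \<open>blast+\<close>)
qed

section \<open>Pairing and pointwise operations\<close>

text \<open>The common refinement of the partitions of \<open>f\<close> and \<open>g\<close>, indexed by pairs of values.\<close>

definition pairing :: "('i set \<Rightarrow> 'a::frame) \<Rightarrow> ('j set \<Rightarrow> 'a) \<Rightarrow> ('i \<times> 'j) set \<Rightarrow> 'a" where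
  "pairing f g S = (SUP (y, z)\<in>S. inf (f {y}) (g {z}))"

lemma pairing_singleton: "pairing f g {(y, z)} = inf (f {y}) (g {z})"
  by (simp add: pairing_def)

lemma pairing_Times:
  assumes "frame_hom f" "frame_hom g"
  shows "pairing f g (Y \<times> Z) = inf (f Y) (g Z)"
proof -
  have "inf (f Y) (g Z) = (SUP y\<in>Y. SUP z\<in>Z. inf (f {y}) (g {z}))"
    by (simp only: frame_hom_eq_SUP_singletons[OF assms(1), of Y]
        frame_hom_eq_SUP_singletons[OF assms(2), of Z] frame_SUP_inf)
  also have "\<dots> = pairing f g (Y \<times> Z)"
    unfolding pairing_def
    by (rule antisym) (auto intro!: SUP_least intro: SUP_upper2)
  finally show ?thesis by simp
qed

lemma frame_hom_pairing:
  assumes "frame_hom f" "frame_hom g"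
  shows "frame_hom (pairing f g)"
proof -
  have "frame_hom (\<lambda>S. SUP p\<in>S. (case p of (y, z) \<Rightarrow> inf (f {y}) (g {z})))"
  proof (rule frame_hom_partition)
    have "(SUP p. (case p of (y, z) \<Rightarrow> inf (f {y}) (g {z}))) = pairing f g (UNIV \<times> UNIV)"
      by (simp add: pairing_def)
    then show "(SUP p. (case p of (y, z) \<Rightarrow> inf (f {y}) (g {z}))) = top"
      using assms frame_hom_top[of f] frame_hom_top[of g] by (simp only: pairing_Times) simp
  next
    fix p q :: "'a \<times> 'c"
    obtain y z y' z' where pq: "p = (y, z)" "q = (y', z')" by fastforce
    have "inf (inf (f {y}) (g {z})) (inf (f {y'}) (g {z'})) =
        inf (inf (f {y}) (f {y'})) (inf (g {z}) (g {z'}))"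
      by (simp add: inf_commute inf_left_commute inf_assoc)
    moreover assume "p \<noteq> q"
    ultimately show "inf (case p of (y, z) \<Rightarrow> inf (f {y}) (g {z}))
        (case q of (y, z) \<Rightarrow> inf (f {y}) (g {z})) = bot"
      using pq frame_hom_disjoint_values[OF assms(1), of y y']
        frame_hom_disjoint_values[OF assms(2), of z z'] by auto
  qed
  then show ?thesis unfolding pairing_def .
qed

text \<open>
  The rectangles \<open>Y \<times> Z\<close> in the definition of \<open>rc_op\<close> are those inside the preimage of \<open>X\<close>
  under \<open>d\<close>, and the one-point rectangles among them already exhaust that preimage.
\<close>

lemma rc_op_eq_pairing:
  assumes f: "frame_hom f" and g: "frame_hom g"
  shows "rc_op d f g X = pairing f g ((\<lambda>(y, z). d y z) -` X)"
  unfolding rc_op_def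
proof (rule antisym)
  show "Sup {inf (f Y) (g Z) | Y Z. {d y z | y z. y \<in> Y \<and> z \<in> Z} \<subseteq> X}
      \<le> pairing f g ((\<lambda>(y, z). d y z) -` X)"
  proof (rule Sup_least, clarify)
    fix Y Z
    assume "{d y z | y z. y \<in> Y \<and> z \<in> Z} \<subseteq> X"
    then have "Y \<times> Z \<subseteq> (\<lambda>(y, z). d y z) -` X" by (auto simp: subset_eq)
    then show "inf (f Y) (g Z) \<le> pairing f g ((\<lambda>(y, z). d y z) -` X)"
      unfolding pairing_Times[OF f g, symmetric]
      by (rule frame_hom_mono[OF frame_hom_pairing[OF f g]])
  qed
next
  show "pairing f g ((\<lambda>(y, z). d y z) -` X)
      \<le> Sup {inf (f Y) (g Z) | Y Z. {d y z | y z. y \<in> Y \<and> z \<in> Z} \<subseteq> X}"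
    unfolding pairing_def
  proof (rule SUP_least, clarsimp)
    fix y z assume "d y z \<in> X"
    then show "inf (f {y}) (g {z})
        \<le> Sup {inf (f Y) (g Z) | Y Z. {d y z | y z. y \<in> Y \<and> z \<in> Z} \<subseteq> X}"
      by (intro Sup_upper CollectI exI[of _ "{y}"] exI[of _ "{z}"]) auto
  qed
qed

lemma frame_hom_rc_op:
  assumes "frame_hom f" "frame_hom g"
  shows "frame_hom (rc_op d f g)"
proof -
  have "rc_op d f g = (\<lambda>X. pairing f g ((\<lambda>(y, z). d y z) -` X))"
    by (rule ext) (rule rc_op_eq_pairing[OF assms])
  then show ?thesis
    using frame_hom_vimage[OF frame_hom_pairing[OF assms]] by simp
qed

lemma rc_op_value:
  assumes "a \<le> f {y}" "a \<le> g {z}"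
  shows "a \<le> rc_op d f g {d y z}"
proof -
  have "inf (f {y}) (g {z}) \<le> rc_op d f g {d y z}"
    unfolding rc_op_def
    by (intro Sup_upper CollectI exI[of _ "{y}"] exI[of _ "{z}"]) auto
  then show ?thesis using assms by (meson le_inf_iff order_trans)
qed

lemma frame_hom_const: "frame_hom (rc_const r :: real set \<Rightarrow> 'a::frame)"
  unfolding frame_hom_def
proof (intro conjI allI)
  fix S :: "real set set"
  show "rc_const r (Sup S) = (SUP X\<in>S. rc_const r X :: 'a)"
  proof (cases "\<exists>X\<in>S. r \<in> X")
    case True
    then obtain X where "X \<in> S" "r \<in> X" by blast
    then have "top \<le> (SUP X\<in>S. rc_const r X :: 'a)"
      by (intro SUP_upper2[of X]) (simp_all add: rc_const_def)
    then show ?thesis using True by (auto simp: rc_const_def top_unique)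
  next
    case False
    then have "(SUP X\<in>S. rc_const r X :: 'a) \<le> bot"
      by (intro SUP_least) (auto simp: rc_const_def)
    then show ?thesis using False by (auto simp: rc_const_def bot_unique)
  qed
qed (auto simp: rc_const_def)

lemma rc_const_value: "a \<le> rc_const r {r}"
  by (simp add: rc_const_def)

text \<open>
  The transfer principle for the ring laws: an identity may be checked on an arbitrary part \<open>a\<close>
  of the frame on which the homomorphisms that occur in it are constant.
\<close>

lemma frame_hom_eqI3:
  fixes f :: "'i set \<Rightarrow> 'a::frame" and g :: "'j set \<Rightarrow> 'a" and h :: "'k set \<Rightarrow> 'a"
  assumes "frame_hom f" "frame_hom g" "frame_hom h" "frame_hom F" "frame_hom G"
    and common: "\<And>a x y z. a \<le> f {x} \<Longrightarrow> a \<le> g {y} \<Longrightarrow> a \<le> h {z} \<Longrightarrow>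
      \<exists>v. a \<le> F {v} \<and> a \<le> G {v}"
  shows "F = G"
proof (rule frame_hom_eqI)
  show "frame_hom (pairing f (pairing g h))"
    using assms by (intro frame_hom_pairing)
  fix p :: "'i \<times> 'j \<times> 'k"
  obtain x y z where p: "p = (x, y, z)" by (cases p)
  show "\<exists>v. pairing f (pairing g h) {p} \<le> F {v} \<and> pairing f (pairing g h) {p} \<le> G {v}"
    unfolding p pairing_singleton
    by (rule common[of _ x y z]) (simp_all add: le_infI1 le_infI2)
qed fact+

section \<open>Continuity\<close>

lemma subframe_top: "subframe \<tau> \<Longrightarrow> top \<in> \<tau>"
  and subframe_inf: "subframe \<tau> \<Longrightarrow> a \<in> \<tau> \<Longrightarrow> b \<in> \<tau> \<Longrightarrow> inf a b \<in> \<tau>"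
  and subframe_Sup: "subframe \<tau> \<Longrightarrow> S \<subseteq> \<tau> \<Longrightarrow> Sup S \<in> \<tau>"
  by (auto simp: subframe_def)

lemma subframe_bot: "subframe \<tau> \<Longrightarrow> bot \<in> \<tau>"
  using subframe_Sup[of \<tau> "{}"] by simp

lemma subframe_sup: "subframe \<tau> \<Longrightarrow> a \<in> \<tau> \<Longrightarrow> b \<in> \<tau> \<Longrightarrow> sup a b \<in> \<tau>"
  using subframe_Sup[of \<tau> "{a, b}"] by simp

lemma real_continuous_hom: "real_continuous \<tau> f \<Longrightarrow> frame_hom f"
  by (simp add: real_continuous_def)

text \<open>
  An open set is the union of the intervals with rational endpoints that it contains, so the
  condition that defines continuity reaches all open sets.
\<close>

lemma real_continuous_open:
  assumes \<tau>: "subframe \<tau>" and f: "real_continuous \<tau> f" and U: "open U"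
  shows "f U \<in> \<tau>"
proof -
  define I where "I = {{x::real. of_rat p < x \<and> x < of_rat q} | p q.
    {x::real. of_rat p < x \<and> x < of_rat q} \<subseteq> U}"
  have "U = Sup I"
  proof
    show "U \<subseteq> Sup I"
    proof
      fix x assume "x \<in> U"
      then obtain e where e: "e > 0" "\<And>y. dist y x < e \<Longrightarrow> y \<in> U"
        using U by (meson open_dist)
      obtain p q where pq: "x - e < of_rat p" "of_rat p < x" "x < of_rat q" "of_rat q < x + e"
        using of_rat_dense[of "x - e" x] of_rat_dense[of x "x + e"] e(1) by auto
      then have "{y. of_rat p < y \<and> y < of_rat q} \<subseteq> U"
        by (auto simp: dist_real_def intro!: e(2))
      then show "x \<in> Sup I"
        unfolding I_def using pq by blast
    qed
  qed (auto simp: I_def)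
  then have "f U = Sup (f ` I)"
    using f frame_hom_Sup real_continuous_hom by metis
  moreover have "f ` I \<subseteq> \<tau>"
    using f by (auto simp: I_def real_continuous_def)
  ultimately show ?thesis using subframe_Sup[OF \<tau>] by simp
qed

lemma real_continuousI:
  assumes "frame_hom f" "\<And>a b. f {a<..<b} \<in> \<tau>"
  shows "real_continuous \<tau> f"
  using assms unfolding real_continuous_def greaterThanLessThan_eq
  by (simp add: Collect_conj_eq greaterThan_def lessThan_def)

text \<open>
  An open set of the plane is the union of the open rectangles that it contains, and
  \<open>pairing_Times\<close> evaluates each of these by a meet in \<open>\<tau>\<close>.
\<close>

lemma pairing_open:
  assumes \<tau>: "subframe \<tau>" and f: "real_continuous \<tau> f" and g: "real_continuous \<tau> g"
    and S: "open S"
  shows "pairing f g S \<in> \<tau>"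
proof -
  define I where "I = {U \<times> V | U V. open U \<and> open V \<and> U \<times> V \<subseteq> S}"
  note hom = real_continuous_hom[OF f] real_continuous_hom[OF g]
  have "S = Sup I"
  proof
    show "S \<subseteq> Sup I"
    proof
      fix p assume "p \<in> S"
      with S obtain U V where "open U" "open V" "p \<in> U \<times> V" "U \<times> V \<subseteq> S"
        by (rule open_prod_elim)
      then show "p \<in> Sup I" unfolding I_def by blast
    qed
  qed (auto simp: I_def)
  then have "pairing f g S = Sup (pairing f g ` I)"
    using frame_hom_Sup[OF frame_hom_pairing[OF hom]] by metis
  moreover have "pairing f g ` I \<subseteq> \<tau>"
    by (auto simp: I_def pairing_Times[OF hom] intro!: subframe_inf[OF \<tau>]
        real_continuous_open[OF \<tau> f] real_continuous_open[OF \<tau> g])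
  ultimately show ?thesis using subframe_Sup[OF \<tau>] by simp
qed

lemma real_continuous_rc_op:
  assumes \<tau>: "subframe \<tau>" and f: "real_continuous \<tau> f" and g: "real_continuous \<tau> g"
    and d: "continuous_on UNIV (\<lambda>(y, z). d y z)"
  shows "real_continuous \<tau> (rc_op d f g)"
proof (rule real_continuousI)
  note hom = real_continuous_hom[OF f] real_continuous_hom[OF g]
  show "frame_hom (rc_op d f g)" by (rule frame_hom_rc_op[OF hom])
  fix a b :: real
  show "rc_op d f g {a<..<b} \<in> \<tau>"
    unfolding rc_op_eq_pairing[OF hom]
    by (intro pairing_open[OF \<tau> f g] open_vimage[OF _ d]) simp
qed

lemma real_continuous_vimage:
  assumes \<tau>: "subframe \<tau>" and f: "real_continuous \<tau> f" and "continuous_on UNIV \<phi>"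
  shows "real_continuous \<tau> (\<lambda>X. f (\<phi> -` X))"
  using assms(3)
  by (intro real_continuousI frame_hom_vimage[OF real_continuous_hom[OF f]]
      real_continuous_open[OF \<tau> f] open_vimage) simp_all

lemma real_continuous_const: "subframe \<tau> \<Longrightarrow> real_continuous \<tau> (rc_const r)"
  by (intro real_continuousI frame_hom_const)
    (simp add: rc_const_def subframe_top subframe_bot)

lemma real_continuous_add:
  "subframe \<tau> \<Longrightarrow> real_continuous \<tau> f \<Longrightarrow> real_continuous \<tau> g \<Longrightarrow> real_continuous \<tau> (rc_op (+) f g)"
  by (rule real_continuous_rc_op) (auto simp: case_prod_unfold intro!: continuous_intros)

lemma real_continuous_mult:
  "subframe \<tau> \<Longrightarrow> real_continuous \<tau> f \<Longrightarrow> real_continuous \<tau> g \<Longrightarrow> real_continuous \<tau> (rc_op (*) f g)"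
  by (rule real_continuous_rc_op) (auto simp: case_prod_unfold intro!: continuous_intros)

section \<open>The ring of real-continuous functions\<close>

lemma rc_op_commute:
  assumes f: "frame_hom f" and g: "frame_hom g" and d: "\<And>x y. d x y = d y x"
  shows "rc_op d f g = rc_op d g f"
proof (rule frame_hom_eqI3[OF f g g])
  fix a x y assume "a \<le> f {x}" "a \<le> g {y}"
  then show "\<exists>v. a \<le> rc_op d f g {v} \<and> a \<le> rc_op d g f {v}"
    by (metis d rc_op_value)
qed (intro frame_hom_rc_op f g)+

lemma rc_op_assoc:
  assumes f: "frame_hom f" and g: "frame_hom g" and h: "frame_hom h"
    and d: "\<And>x y z. d (d x y) z = d x (d y z)"
  shows "rc_op d (rc_op d f g) h = rc_op d f (rc_op d g h)"
proof (rule frame_hom_eqI3[OF f g h])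
  fix a x y z assume v: "a \<le> f {x}" "a \<le> g {y}" "a \<le> h {z}"
  have "a \<le> rc_op d (rc_op d f g) h {d (d x y) z}" "a \<le> rc_op d f (rc_op d g h) {d x (d y z)}"
    by (intro rc_op_value v)+
  then show "\<exists>v. a \<le> rc_op d (rc_op d f g) h {v} \<and> a \<le> rc_op d f (rc_op d g h) {v}"
    using d by metis
qed (intro frame_hom_rc_op f g h)+

lemma rc_op_const_left:
  assumes f: "frame_hom f" and d: "\<And>x. d r x = x"
  shows "rc_op d (rc_const r) f = f"
proof (rule frame_hom_eqI3[OF f f f])
  fix a x assume "a \<le> f {x}"
  then show "\<exists>v. a \<le> rc_op d (rc_const r) f {v} \<and> a \<le> f {v}"
    by (metis d rc_const_value rc_op_value)
qed (intro frame_hom_rc_op frame_hom_const f)+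

lemma rc_op_distrib:
  assumes f: "frame_hom f" and g: "frame_hom g" and h: "frame_hom h"
  shows "rc_op (*) (rc_op (+) f g) h = rc_op (+) (rc_op (*) f h) (rc_op (*) g h)"
proof (rule frame_hom_eqI3[OF f g h])
  fix a x y z assume v: "a \<le> f {x}" "a \<le> g {y}" "a \<le> h {z}"
  have "a \<le> rc_op (*) (rc_op (+) f g) h {(x + y) * z}"
    "a \<le> rc_op (+) (rc_op (*) f h) (rc_op (*) g h) {x * z + y * z}"
    by (intro rc_op_value v)+
  then show "\<exists>v. a \<le> rc_op (*) (rc_op (+) f g) h {v} \<and>
      a \<le> rc_op (+) (rc_op (*) f h) (rc_op (*) g h) {v}"
    by (metis distrib_right)
qed (intro frame_hom_rc_op f g h)+

lemma vimage_value:
  assumes "frame_hom f" "a \<le> f {x}"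
  shows "a \<le> f (\<phi> -` {\<phi> x})"
  using assms(2) frame_hom_mono[OF assms(1), of "{x}" "\<phi> -` {\<phi> x}"] by auto

lemma rc_op_negative:
  assumes f: "frame_hom f"
  shows "rc_op (+) (\<lambda>X. f (uminus -` X)) f = rc_const 0"
proof (rule frame_hom_eqI3[OF f f f])
  fix a x assume v: "a \<le> f {x}"
  have "a \<le> rc_op (+) (\<lambda>X. f (uminus -` X)) f {- x + x}"
    by (rule rc_op_value, rule vimage_value[OF f v], rule v)
  then show "\<exists>v. a \<le> rc_op (+) (\<lambda>X. f (uminus -` X)) f {v} \<and> a \<le> rc_const 0 {v}"
    by (intro exI[of _ 0]) (simp add: rc_const_value)
qed (intro frame_hom_rc_op frame_hom_const frame_hom_vimage f)+

lemma cring_RL: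
  assumes \<tau>: "subframe \<tau>"
  shows "cring (RL \<tau>)"
proof (rule cringI)
  show "abelian_group (RL \<tau>)"
  proof (rule abelian_groupI)
    fix f assume "f \<in> carrier (RL \<tau>)"
    then have f: "real_continuous \<tau> f" by (simp add: RL_def)
    have "real_continuous \<tau> (\<lambda>X. f (uminus -` X))"
      by (intro real_continuous_vimage[OF \<tau> f] continuous_intros)
    then show "\<exists>g\<in>carrier (RL \<tau>). g \<oplus>\<^bsub>RL \<tau>\<^esub> f = \<zero>\<^bsub>RL \<tau>\<^esub>"
      using rc_op_negative[OF real_continuous_hom[OF f]] by (auto simp: RL_def)
  qed (auto simp: RL_def real_continuous_add real_continuous_const \<tau> real_continuous_hom
      intro: rc_op_assoc rc_op_commute rc_op_const_left)
  show "comm_monoid (RL \<tau>)"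
    by (rule comm_monoidI)
      (auto simp: RL_def real_continuous_mult real_continuous_const \<tau> real_continuous_hom
        intro: rc_op_assoc rc_op_commute rc_op_const_left)
qed (simp add: RL_def rc_op_distrib real_continuous_hom)

section \<open>Regularity\<close>

text \<open>
  With \<open>inverse 0 = 0\<close>, the preimage of an interval under inversion is an open set,
  together with the point \<open>0\<close> if the interval contains it.
\<close>

lemma real_continuous_quasi_inverse:
  assumes \<tau>: "subframe \<tau>" and f: "real_continuous \<tau> f" and zero: "zero_element f \<in> \<tau>"
  shows "real_continuous \<tau> (\<lambda>X. f (inverse -` X))"
proof (rule real_continuousI)
  note hom = real_continuous_hom[OF f]
  show "frame_hom (\<lambda>X. f (inverse -` X))" by (rule frame_hom_vimage[OF hom])
  fix a b :: real
  let ?U = "{x. x \<noteq> 0} \<inter> inverse -` {a<..<b}"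
  have "continuous_on {x::real. x \<noteq> 0} inverse" by (intro continuous_intros) auto
  moreover have "open {x::real. x \<noteq> 0}" by (simp add: open_Collect_neq)
  ultimately have "open ?U"
    using continuous_on_open_vimage[of "{x::real. x \<noteq> 0}" inverse] by (simp add: Int_commute)
  then have U: "f ?U \<in> \<tau>" by (rule real_continuous_open[OF \<tau> f])
  show "f (inverse -` {a<..<b}) \<in> \<tau>"
  proof (cases "0 \<in> {a<..<b}")
    case True
    then have "inverse -` {a<..<b} = Sup {?U, {0}}" by auto
    then have "f (inverse -` {a<..<b}) = sup (f ?U) (f {0})"
      using frame_hom_Sup[OF hom, of "{?U, {0}}"] by simp
    then show ?thesis
      using subframe_sup[OF \<tau> U] zero by (simp add: zero_element_def)
  next
    case False
    then have "inverse -` {a<..<b} = ?U" by auto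
    then show ?thesis using U by simp
  qed
qed

lemma quasi_inverse_regular:
  assumes f: "frame_hom f"
  shows "f = rc_op (*) (rc_op (*) f f) (\<lambda>X. f (inverse -` X))"
proof (rule frame_hom_eqI3[OF f f f])
  fix a x assume v: "a \<le> f {x}"
  have "a \<le> rc_op (*) (rc_op (*) f f) (\<lambda>X. f (inverse -` X)) {x * x * inverse x}"
    by (rule rc_op_value, intro rc_op_value v, rule vimage_value[OF f v])
  moreover have "x * x * inverse x = x" by (cases "x = 0") simp_all
  ultimately show "\<exists>v. a \<le> f {v} \<and> a \<le> rc_op (*) (rc_op (*) f f) (\<lambda>X. f (inverse -` X)) {v}"
    using v by (intro exI[of _ x]) simp
qed (intro frame_hom_rc_op frame_hom_vimage f)+

text \<open>
  A piece on which \<open>f\<close> is \<open>y\<close> and \<open>g\<close> is \<open>z\<close> can only be nonzero if \<open>y = y * y * z\<close>; then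
  \<open>y * z\<close> lies in \<open>(-1, 1)\<close> exactly when \<open>y = 0\<close>.
\<close>

lemma zero_element_of_regular:
  assumes f: "frame_hom f" and g: "frame_hom g"
    and eq: "f = rc_op (*) (rc_op (*) f f) g"
  shows "zero_element f = rc_op (*) f g {-1<..<1}"
  unfolding zero_element_def rc_op_eq_pairing[OF f g]
proof (rule antisym)
  have "f {0} = pairing f g ({0} \<times> UNIV)"
    using frame_hom_top[OF g] by (simp add: pairing_Times[OF f g])
  also have "\<dots> \<le> pairing f g ((\<lambda>(y, z). y * z) -` {-1<..<1})"
    by (intro frame_hom_mono[OF frame_hom_pairing[OF f g]]) auto
  finally show "f {0} \<le> pairing f g ((\<lambda>(y, z). y * z) -` {-1<..<1})" .
next
  show "pairing f g ((\<lambda>(y, z). y * z) -` {-1<..<1}) \<le> f {0}"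
    unfolding pairing_def
  proof (rule SUP_least, clarify)
    fix y z :: real
    assume yz: "y * z \<in> {-1<..<1}"
    let ?a = "inf (f {y}) (g {z})"
    show "?a \<le> f {0}"
    proof (cases "y = 0")
      case False
      have "y \<noteq> y * y * z"
      proof
        assume "y = y * y * z"
        then have "y * 1 = y * (y * z)" by (simp add: mult.assoc)
        then have "y * z = 1" using False by (metis mult_left_cancel)
        then show False using yz by simp
      qed
      moreover have "?a \<le> rc_op (*) (rc_op (*) f f) g {y * y * z}"
        by (intro rc_op_value) simp_all
      then have "?a \<le> f {y * y * z}" by (simp add: eq[symmetric])
      then have "?a \<le> inf (f {y}) (f {y * y * z})" by simp
      ultimately have "?a \<le> bot" using frame_hom_disjoint_values[OF f] by metis
      then show ?thesis by (simp add: bot_unique)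
    qed simp
  qed
qed

theorem theorem2:
  fixes \<tau> :: "'a::frame set"
  assumes "topoframe \<tau>"
  shows "P_topoframe \<tau> \<longleftrightarrow> von_neumann_regular_ring (RL \<tau>)"
proof -
  have \<tau>: "subframe \<tau>" using assms by (simp add: topoframe_def)
  interpret cring "RL \<tau>" by (rule cring_RL[OF \<tau>])
  have square: "f [^]\<^bsub>RL \<tau>\<^esub> (2::nat) = rc_op (*) f f" if "f \<in> carrier (RL \<tau>)" for f
  proof -
    have "f [^]\<^bsub>RL \<tau>\<^esub> (2::nat) = f \<otimes>\<^bsub>RL \<tau>\<^esub> f"
      using that by (simp add: numeral_2_eq_2)
    then show ?thesis by (simp add: RL_def)
  qed
  show ?thesis
  proof
    assume P: "P_topoframe \<tau>"
    show "von_neumann_regular_ring (RL \<tau>)"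
    proof unfold_locales
      fix f assume f: "f \<in> carrier (RL \<tau>)"
      then have rc: "real_continuous \<tau> f" by (simp add: RL_def)
      let ?g = "\<lambda>X. f (inverse -` X)"
      have "zero_element f \<in> \<tau>" using P f by (simp add: P_topoframe_def)
      then have "?g \<in> carrier (RL \<tau>)"
        using real_continuous_quasi_inverse[OF \<tau> rc] by (simp add: RL_def)
      moreover have "f = f [^]\<^bsub>RL \<tau>\<^esub> (2::nat) \<otimes>\<^bsub>RL \<tau>\<^esub> ?g"
        unfolding square[OF f]
        using quasi_inverse_regular[OF real_continuous_hom[OF rc]] by (simp add: RL_def)
      ultimately show "\<exists>g\<in>carrier (RL \<tau>). f = f [^]\<^bsub>RL \<tau>\<^esub> (2::nat) \<otimes>\<^bsub>RL \<tau>\<^esub> g"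
        by blast
    qed
  next
    assume "von_neumann_regular_ring (RL \<tau>)"
    then interpret von_neumann_regular_ring "RL \<tau>" .
    have "zero_element f \<in> \<tau>" if f: "f \<in> carrier (RL \<tau>)" for f
    proof -
      obtain g where g: "g \<in> carrier (RL \<tau>)"
        and eq: "f = f [^]\<^bsub>RL \<tau>\<^esub> (2::nat) \<otimes>\<^bsub>RL \<tau>\<^esub> g"
        using regular[OF f] by blast
      have rc: "real_continuous \<tau> f" "real_continuous \<tau> g"
        using f g by (simp_all add: RL_def)
      have "f = rc_op (*) (rc_op (*) f f) g"
        using eq unfolding square[OF f] by (simp add: RL_def)
      then have "zero_element f = rc_op (*) f g {-1<..<1}"
        using rc by (intro zero_element_of_regular real_continuous_hom)
      moreover have "rc_op (*) f g {-1<..<1} \<in> \<tau>"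
        by (rule real_continuous_open[OF \<tau> real_continuous_mult[OF \<tau> rc]]) simp
      ultimately show ?thesis by simp
    qed
    then show "P_topoframe \<tau>" using assms by (simp add: P_topoframe_def)
  qed
qed

end
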